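(* There exist a compact convex polyhedron $M\subset\mathbb{R}^3$ and two points $x,y$ on the boundary of $M$ such that the shortest path on the boundary of $M$ joining $x$ and $y$ is unique and its total curvature exceeds $2\pi$.
   Context: A shortest path on the boundary of $M$ joining $x$ and $y$ is a path contained in $\mathrm{bd}\,M$ from $x$ to $y$ whose length is minimal among all such paths; it is a polygonal path. The total curvature of a polygonal path $P=[z_0,z_1,\ldots,z_n]$ (with consecutive vertices distinct) is $$t(P)=\sum_{i=1}^{n-1}\bigl(\pi-\angle z_{i-1}z_iz_{i+1}\bigr).$$ *)

theory Defs
  imports "HOL-Analysis.Analysis"
begin

text \<open>Length of a path parametrized over the unit interval: the supremum of the lengths of inscribed
  polygons, with value \<open>\<infinity>\<close> for non-rectifiable paths. In a pair \<open>(n, t)\<close> the points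
  \<open>t 0 \<le> \<dots> \<le> t n\<close> form the subdivision.\<close>

definition path_length :: "(real \<Rightarrow> 'a::metric_space) \<Rightarrow> ennreal" where
  "path_length g =
     (SUP (n, t) \<in> {(n::nat, t::nat \<Rightarrow> real). mono_on {..n} t \<and> t ` {..n} \<subseteq> {0..1}}.
        \<Sum>i<n. ennreal (dist (g (t i)) (g (t (Suc i)))))"

definition boundary_path ::
    "'a::euclidean_space set \<Rightarrow> 'a \<Rightarrow> 'a \<Rightarrow> (real \<Rightarrow> 'a) \<Rightarrow> bool" where
  "boundary_path M x y g \<longleftrightarrow>
     path g \<and> pathstart g = x \<and> pathfinish g = y \<and> path_image g \<subseteq> frontier M"

definition shortest_boundary_path ::
    "'a::euclidean_space set \<Rightarrow> 'a \<Rightarrow> 'a \<Rightarrow> (real \<Rightarrow> 'a) \<Rightarrow> bool" where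
  "shortest_boundary_path M x y g \<longleftrightarrow>
     boundary_path M x y g \<and> (\<forall>h. boundary_path M x y h \<longrightarrow> path_length g \<le> path_length h)"

text \<open>The value on the empty list is a dummy.\<close>

fun polygonal_path :: "'a::real_normed_vector list \<Rightarrow> real \<Rightarrow> 'a" where
  "polygonal_path [] = linepath 0 0"
| "polygonal_path [a] = linepath a a"
| "polygonal_path [a, b] = linepath a b"
| "polygonal_path (a # b # c # zs) = linepath a b +++ polygonal_path (b # c # zs)"

text \<open>The unsigned angle \<open>\<angle> a b c\<close> at \<open>b\<close>, in \<open>[0, \<pi>]\<close>; meaningful for \<open>a \<noteq> b\<close> and \<open>c \<noteq> b\<close>.\<close>

definition angle :: "'a::real_inner \<Rightarrow> 'a \<Rightarrow> 'a \<Rightarrow> real" where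
  "angle a b c = arccos (((a - b) \<bullet> (c - b)) / (norm (a - b) * norm (c - b)))"

text \<open>For \<open>zs = [z\<^sub>0, \<dots>, z\<^sub>n]\<close> the sum ranges over the inner vertices, \<open>i = 1, \<dots>, n - 1\<close>.\<close>

definition total_curvature :: "'a::real_inner list \<Rightarrow> real" where
  "total_curvature zs =
     (\<Sum>i\<in>{1..<length zs - 1}. pi - angle (zs ! (i - 1)) (zs ! i) (zs ! (i + 1)))"

end

theory Submission
  imports Defs
begin

text \<open>
  The solid is symmetric in the plane \<open>x = 0\<close>; on the side \<open>x \<ge> 0\<close> its boundary consists of a bottom, a
  slanted side, a bevel and an almost horizontal roof. The shortest path runs a long way along the
  bottom and, at either end, climbs over the side and the bevel onto the roof, turning there by
  \<open>arccos (1/3) + arccos (2/3) + arccos (53/117)\<close>, slightly more than \<open>\<pi>\<close>. A planar route over the two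
  edges of a thin plate would turn by less than \<open>\<pi>\<close>; the excess comes from the path leaving the plane.

  Minimality is shown by a calibration, a function that is 1-Lipschitz on every face and grows with
  unit speed along the path. A boundary path can be replaced by a finite chain of chords, each within a
  single face (leave a face at the last time the path visits it), so its length is at least the
  increase of the calibration. In case of equality every chord is parallel to the gradient of the
  calibration, which keeps the chain on the path.
\<close>

subsection \<open>Chains and calibrations\<close>

fun polygon_length :: "'a::metric_space list \<Rightarrow> real" where
  "polygon_length (a # b # ps) = dist a b + polygon_length (b # ps)"
| "polygon_length _ = 0"

lemma polygon_length_nonneg: "0 \<le> polygon_length ps"
  by (induction ps rule: polygon_length.induct) auto

lemma polygon_length_append:
  "polygon_length (ps @ p # qs) = polygon_length (ps @ [p]) + polygon_length (p # qs)"
  by (induction ps rule: polygon_length.induct) (auto split: list.split simp: neq_Nil_conv)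

lemma polygon_length_conv_sum:
  "polygon_length ps = (\<Sum>i<length ps - 1. dist (ps ! i) (ps ! Suc i))"
proof (induction ps rule: polygon_length.induct)
  case (1 a b ps)
  then show ?case
    by (simp add: sum.lessThan_Suc_shift del: sum.lessThan_Suc)
qed auto

lemma polygon_length_le_path_length:
  assumes "sorted ts" and "set ts \<subseteq> {0..1}"
  shows "ennreal (polygon_length (map g ts)) \<le> path_length g"
proof (cases "ts = []")
  case False
  \<comment> \<open>A subdivision \<open>(n, t)\<close> has the \<open>n + 1\<close> points
    \<open>t 0\<close>, ..., \<open>t n\<close>.\<close>
  define n where "n = length ts - 1"
  have len: "length ts = Suc n" using False by (simp add: n_def)
  have mem: "(n, (!) ts) \<in> {(n, t). mono_on {..n} t \<and> t ` {..n} \<subseteq> {0..1}}"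
    using assms nth_mem[of _ ts] unfolding mono_on_def
    by (auto simp: len less_Suc_eq_le sorted_iff_nth_mono simp del: nth_mem)
  have "ennreal (polygon_length (map g ts))
      = (\<Sum>i<n. ennreal (dist (g (ts ! i)) (g (ts ! Suc i))))"
    by (simp add: polygon_length_conv_sum len sum_ennreal)
  also have "\<dots> \<le> path_length g"
    unfolding path_length_def by (rule SUP_upper2[OF mem]) auto
  finally show ?thesis .
qed auto

text \<open>Here \<open>s\<close> acts as an arc length function, so that the sums over subdivisions
  telescope.\<close>

lemma path_length_le:
  assumes mono: "\<And>a b. 0 \<le> a \<Longrightarrow> a \<le> b \<Longrightarrow> b \<le> 1 \<Longrightarrow> dist (g a) (g b) \<le> s b - s a"
  shows "path_length g \<le> ennreal (s 1 - s 0)"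
  unfolding path_length_def
proof (rule SUP_least)
  fix nt :: "nat \<times> (nat \<Rightarrow> real)"
  assume "nt \<in> {(n, t). mono_on {..n} t \<and> t ` {..n} \<subseteq> {0..1}}"
  then obtain n t where nt: "nt = (n, t)" and t: "mono_on {..n} t" "t ` {..n} \<subseteq> {0..1}"
    by auto
  have tt: "0 \<le> t i" "t i \<le> 1" if "i \<le> n" for i using t(2) that by auto
  have le: "t i \<le> t (Suc i)" if "i < n" for i
    using monotone_onD[OF t(1), of i "Suc i"] that by auto
  have "(\<Sum>i<n. dist (g (t i)) (g (t (Suc i)))) \<le> (\<Sum>i<n. s (t (Suc i)) - s (t i))"
    by (intro sum_mono mono) (auto simp: tt le Suc_leI)
  also have "\<dots> = s (t n) - s (t 0)"
    by (rule sum_lessThan_telescope)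
  \<comment> \<open>A subdivision may begin after 0 and end before 1; \<open>s\<close> does not
    decrease on the two intervals left over, since distances are nonnegative.\<close>
  also have "\<dots> \<le> s 1 - s 0"
    using order_trans[OF zero_le_dist mono[of 0 "t 0"]] order_trans[OF zero_le_dist mono[of "t n" 1]]
      tt[of 0] tt[of n] by simp
  finally show "(case nt of (n, t) \<Rightarrow> \<Sum>i<n. ennreal (dist (g (t i)) (g (t (Suc i)))))
      \<le> ennreal (s 1 - s 0)"
    by (simp add: nt sum_ennreal ennreal_leI)
qed

text \<open>Induction on the number of closed sets. After the last visit \<open>c\<close> to a set
  \<open>F\<close> containing \<open>g a\<close>, the path stays in the other sets. Their union is
  closed, so it contains \<open>g c\<close> too, and the induction hypothesis applies from
  \<open>c\<close> on.\<close>

lemma exists_chain: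
  fixes g :: "real \<Rightarrow> 'a::metric_space"
  assumes "finite \<F>" and "\<And>F. F \<in> \<F> \<Longrightarrow> closed F"
    and "a \<le> b" and "continuous_on {a..b} g" and "g ` {a..b} \<subseteq> \<Union>\<F>"
  shows "\<exists>ts. sorted (a # ts) \<and> set (a # ts) \<subseteq> {a..b} \<and> last (a # ts) = b \<and>
    successively (\<lambda>p q. \<exists>F\<in>\<F>. p \<in> F \<and> q \<in> F) (map g (a # ts))"
  using assms
proof (induction "card \<F>" arbitrary: \<F> a rule: less_induct)
  case less
  obtain F where F: "F \<in> \<F>" "g a \<in> F" using less.prems by force
  define A where "A = {t \<in> {a..b}. g t \<in> F}"
  have "A = {a..b} \<inter> g -` F" by (auto simp: A_def)
  hence "closed A"
    using continuous_closed_preimage[OF less.prems(4) _ less.prems(2)[OF F(1)]] by simp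
  moreover have "A \<subseteq> {a..b}" by (auto simp: A_def)
  ultimately have "compact A"
    by (meson bounded_closed_interval bounded_subset compact_eq_bounded_closed)
  moreover have "a \<in> A" using F less.prems by (auto simp: A_def)
  ultimately obtain c where c: "c \<in> A" "\<And>t. t \<in> A \<Longrightarrow> t \<le> c"
    using compact_attains_sup[of A] by blast
  have ac: "a \<le> c" "c \<le> b" "g c \<in> F" using c by (auto simp: A_def)
  show ?case
  proof (cases "c = b")
    case True
    then show ?thesis using F ac by (intro exI[of _ "[b]"]) auto
  next
    case False
    hence "c < b" using ac by simp
    define G where "G = \<F> - {F}"
    have clG: "closed (\<Union>G)" using less.prems by (auto simp: G_def)
    have sub: "g ` {c<..b} \<subseteq> \<Union>G"
    proof
      fix p assume "p \<in> g ` {c<..b}"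
      then obtain t where t: "c < t" "t \<le> b" "p = g t" by auto
      have "t \<notin> A" using c(2)[of t] t(1) by fastforce
      hence "g t \<notin> F" using t ac by (auto simp: A_def)
      moreover have "t \<in> {a..b}" using t ac by simp
      hence "g t \<in> \<Union>\<F>" using less.prems(5) by blast
      ultimately show "p \<in> \<Union>G" using t(3) by (auto simp: G_def)
    qed
    have contc: "continuous_on {c..b} g"
      using less.prems(4) ac by (auto intro: continuous_on_subset)
    have "closure {c<..b} = {c..b}" using \<open>c < b\<close> by simp
    hence sub2: "g ` {c..b} \<subseteq> \<Union>G"
      using image_closure_subset[of "{c<..b}" g "\<Union>G"] contc clG sub by simp
    have "card G < card \<F>" using F less.prems(1) unfolding G_def by (meson card_Diff1_less)
    from less.hyps[OF this _ _ ac(2) contc sub2] less.prems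
    obtain ts where ts: "sorted (c # ts)" "set (c # ts) \<subseteq> {c..b}" "last (c # ts) = b"
      "successively (\<lambda>p q. \<exists>F\<in>G. p \<in> F \<and> q \<in> F) (map g (c # ts))"
      by (auto simp: G_def)
    have "successively (\<lambda>p q. \<exists>F\<in>\<F>. p \<in> F \<and> q \<in> F) (map g (c # ts))"
      by (rule successively_mono[OF ts(4)]) (auto simp: G_def)
    moreover have "set (a # c # ts) \<subseteq> {a..b}"
      using ts(2) ac less.prems(3) by fastforce
    ultimately show ?thesis using ts(1,3) ac F
      by (intro exI[of _ "c # ts"]) auto
  qed
qed

text \<open>The Lipschitz bound is asked within each piece only: \<open>dist\<close> is the distance
  of the ambient space, which for points of different pieces can be shorter than every route through
  the pieces.\<close>

locale calibration =
  fixes \<F> :: "'a::metric_space set set" and \<Phi> :: "'a \<Rightarrow> real"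
  assumes finite_pieces: "finite \<F>"
    and closed_piece: "F \<in> \<F> \<Longrightarrow> closed F"
    and lipschitz_piece: "F \<in> \<F> \<Longrightarrow> p \<in> F \<Longrightarrow> q \<in> F \<Longrightarrow> \<bar>\<Phi> p - \<Phi> q\<bar> \<le> dist p q"
begin

definition linked :: "'a \<Rightarrow> 'a \<Rightarrow> bool" where
  "linked p q \<longleftrightarrow> (\<exists>F\<in>\<F>. p \<in> F \<and> q \<in> F)"

lemma polygon_length_ge:
  assumes "successively linked ps" and "ps \<noteq> []"
  shows "\<Phi> (last ps) - \<Phi> (hd ps) \<le> polygon_length ps"
  using assms
proof (induction ps rule: polygon_length.induct)
  case (1 a b ps)
  then obtain F where "F \<in> \<F>" "a \<in> F" "b \<in> F" by (auto simp: linked_def)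
  from lipschitz_piece[OF this] 1 show ?case by auto
qed auto

text \<open>Every link obeys the Lipschitz bound, so equality for the chain means equality in each
  link, and \<open>step\<close> carries membership in \<open>Z\<close> backwards from the end. The
  bound \<open>m\<close> serves sets \<open>Z\<close> that stop at a given level of \<Phi>.\<close>

lemma tight_chain:
  assumes step: "\<And>p q. linked p q \<Longrightarrow> q \<in> Z \<Longrightarrow> dist p q = \<Phi> q - \<Phi> p \<Longrightarrow> m \<le> \<Phi> p \<Longrightarrow> p \<in> Z"
    and "successively linked ps" and "ps \<noteq> []" and "m \<le> \<Phi> (hd ps)" and "last ps \<in> Z"
    and "polygon_length ps \<le> \<Phi> (last ps) - \<Phi> (hd ps)"
  shows "hd ps \<in> Z"
  using assms(2-)
proof (induction ps rule: polygon_length.induct)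
  case (1 a b ps)
  from 1 have ab: "linked a b" and bps: "successively linked (b # ps)" by auto
  then obtain F where "F \<in> \<F>" "a \<in> F" "b \<in> F" by (auto simp: linked_def)
  from lipschitz_piece[OF this] polygon_length_ge[OF bps] 1
  have eq: "dist a b = \<Phi> b - \<Phi> a" "polygon_length (b # ps) \<le> \<Phi> (last (b # ps)) - \<Phi> b"
    by auto
  have "b \<in> Z" using 1 bps eq zero_le_dist[of a b] by auto
  with step[OF ab _ eq(1)] 1 show ?case by auto
qed auto

lemma exists_linked_chain:
  assumes "path g" and "path_image g \<subseteq> \<Union>\<F>" and "0 \<le> a" and "a \<le> b" and "b \<le> 1"
  obtains ts where "sorted (a # ts)" "set (a # ts) \<subseteq> {a..b}" "last (a # ts) = b"
    "successively linked (map g (a # ts))"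
proof -
  have c: "continuous_on {a..b} g"
    using assms by (auto simp: path_def intro: continuous_on_subset)
  have s: "g ` {a..b} \<subseteq> \<Union>\<F>"
    using assms by (auto simp: path_image_def)
  have eq: "linked = (\<lambda>p q. \<exists>F\<in>\<F>. p \<in> F \<and> q \<in> F)" by (simp add: linked_def fun_eq_iff)
  show ?thesis using exists_chain[OF finite_pieces closed_piece assms(4) c s] that
    unfolding eq by blast
qed

theorem path_length_ge:
  assumes "path g" and "path_image g \<subseteq> \<Union>\<F>"
  shows "ennreal (\<Phi> (pathfinish g) - \<Phi> (pathstart g)) \<le> path_length g"
proof -
  obtain ts where ts: "sorted (0 # ts)" "set (0 # ts) \<subseteq> {0..1}" "last (0 # ts) = 1"
    "successively linked (map g (0 # ts))"
    using exists_linked_chain[OF assms, of 0 1] by auto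
  have "\<Phi> (pathfinish g) - \<Phi> (pathstart g) \<le> polygon_length (map g (0 # ts))"
    using polygon_length_ge[OF ts(4)] ts(3) last_map[of "0 # ts" g]
    by (simp add: pathfinish_def pathstart_def)
  thus ?thesis
    using polygon_length_le_path_length[OF ts(1,2), of g] by (meson ennreal_leI order_trans)
qed

text \<open>Any \<open>g \<tau>\<close> can be made a vertex of a chain by choosing chains before
  and after \<tau> separately. The two lower bounds add up to the whole increase of \<Phi>, so the
  second chain is tight and leads back from the end to \<open>g \<tau>\<close>.\<close>

theorem path_image_subset_if_tight:
  assumes g: "path g" "path_image g \<subseteq> \<Union>\<F>"
    and tight: "path_length g \<le> ennreal (\<Phi> (pathfinish g) - \<Phi> (pathstart g))"
    and pos: "\<Phi> (pathstart g) \<le> \<Phi> (pathfinish g)"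
    and fin: "pathfinish g \<in> Z"
    and step: "\<And>p q. linked p q \<Longrightarrow> q \<in> Z \<Longrightarrow> dist p q = \<Phi> q - \<Phi> p \<Longrightarrow>
      \<Phi> (pathstart g) \<le> \<Phi> p \<Longrightarrow> p \<in> Z"
  shows "path_image g \<subseteq> Z"
proof
  fix p assume "p \<in> path_image g"
  then obtain \<tau> where \<tau>: "p = g \<tau>" "0 \<le> \<tau>" "\<tau> \<le> 1" by (auto simp: path_image_def)
  obtain us where us: "sorted (0 # us)" "set (0 # us) \<subseteq> {0..\<tau>}" "last (0 # us) = \<tau>"
    "successively linked (map g (0 # us))"
    using exists_linked_chain[OF g, of 0 \<tau>] \<tau> by auto
  obtain vs where vs: "sorted (\<tau> # vs)" "set (\<tau> # vs) \<subseteq> {\<tau>..1}" "last (\<tau> # vs) = 1"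
    "successively linked (map g (\<tau> # vs))"
    using exists_linked_chain[OF g, of \<tau> 1] \<tau> by auto
  \<comment> \<open>The time \<tau> ends the first chain and starts the second; it must occur once
    in the concatenation.\<close>
  define ws where "ws = butlast (0 # us)"
  have ws: "0 # us = ws @ [\<tau>]"
    using us(3) append_butlast_last_id[of "0 # us"] by (simp add: ws_def)
  have sub: "set ws \<subseteq> {0..\<tau>}" using us(2) unfolding ws by simp
  have "sorted (ws @ \<tau> # vs)"
    using us(1) vs(1) sub vs(2) unfolding ws by (fastforce simp: sorted_append)
  moreover have "set (ws @ \<tau> # vs) \<subseteq> {0..1}" using sub vs(2) \<tau> by fastforce
  ultimately have "ennreal (polygon_length (map g (ws @ \<tau> # vs))) \<le> path_length g"
    by (rule polygon_length_le_path_length)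
  moreover have "polygon_length (map g (ws @ \<tau> # vs))
      = polygon_length (map g (0 # us)) + polygon_length (map g (\<tau> # vs))"
    using polygon_length_append[of "map g ws" "g \<tau>" "map g vs"] unfolding ws by simp
  \<comment> \<open>By \<open>pos\<close> the right-hand side is nonnegative, so
    \<open>ennreal\<close> does not truncate it.\<close>
  ultimately have le: "polygon_length (map g (0 # us)) + polygon_length (map g (\<tau> # vs))
      \<le> \<Phi> (pathfinish g) - \<Phi> (pathstart g)"
    using tight pos by (metis diff_ge_0_iff_ge ennreal_le_iff order_trans)
  have u: "\<Phi> p - \<Phi> (pathstart g) \<le> polygon_length (map g (0 # us))"
    using polygon_length_ge[OF us(4)] us(3) last_map[of "0 # us" g] \<tau>(1) by (simp add: pathstart_def)
  have v: "\<Phi> (pathfinish g) - \<Phi> p \<le> polygon_length (map g (\<tau> # vs))"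
    using polygon_length_ge[OF vs(4)] vs(3) last_map[of "\<tau> # vs" g] \<tau>(1) by (simp add: pathfinish_def)
  have lst: "last (map g (\<tau> # vs)) = pathfinish g"
    using vs(3) last_map[of "\<tau> # vs" g] by (simp add: pathfinish_def)
  have "hd (map g (\<tau> # vs)) \<in> Z"
  proof (rule tight_chain[where m = "\<Phi> (pathstart g)", OF step vs(4)])
    show "\<Phi> (pathstart g) \<le> \<Phi> (hd (map g (\<tau> # vs)))"
      using le v polygon_length_nonneg[of "map g (0 # us)"] u \<tau>(1) by simp
  qed (use lst le u fin \<tau>(1) in auto)
  thus "p \<in> Z" using \<tau>(1) by simp
qed

lemma continuous_on_calibration: "continuous_on (\<Union>\<F>) \<Phi>"
proof -
  have "continuous_on F \<Phi>" if "F \<in> \<F>" for F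
  proof (rule lipschitz_on_continuous_on)
    show "1-lipschitz_on F \<Phi>"
      using lipschitz_piece[OF that] by (auto simp: lipschitz_on_def dist_real_def)
  qed
  thus ?thesis
    using continuous_on_closed_Union[of \<F> "\<lambda>F. F" \<Phi>] finite_pieces closed_piece by auto
qed

text \<open>By the intermediate value theorem \<Phi> takes each value \<open>\<Phi> z\<close>
  somewhere along \<open>g\<close>, and injectivity on \<open>Z\<close> identifies the point found
  with \<open>z\<close>.\<close>

lemma path_image_eq_if_inj:
  assumes "path g" and "path_image g \<subseteq> Z" and "Z \<subseteq> \<Union>\<F>" and "inj_on \<Phi> Z"
    and "\<Phi> ` Z \<subseteq> {\<Phi> (pathstart g)..\<Phi> (pathfinish g)}"
  shows "path_image g = Z"
proof
  show "Z \<subseteq> path_image g"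
  proof
    fix z assume z: "z \<in> Z"
    have "continuous_on {0..1} (\<Phi> \<circ> g)"
      using assms(1-3) continuous_on_subset[OF continuous_on_calibration]
      by (intro continuous_on_compose) (auto simp: path_def path_image_def)
    moreover have "\<Phi> (g 0) \<le> \<Phi> z" "\<Phi> z \<le> \<Phi> (g 1)"
      using assms(5) z by (auto simp: pathstart_def pathfinish_def)
    ultimately obtain t where t: "0 \<le> t" "t \<le> 1" "\<Phi> (g t) = \<Phi> z"
      using IVT'[of "\<Phi> \<circ> g" 0 "\<Phi> z" 1] by auto
    hence "g t \<in> path_image g" by (auto simp: path_image_def)
    thus "z \<in> path_image g" using t(3) z assms(2,4) by (metis inj_onD subsetD)
  qed
qed (rule assms(2))

end

subsection \<open>Polygonal paths\<close>

lemma rectifiable_join: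
  fixes g1 g2 :: "real \<Rightarrow> 'a::metric_space"
  assumes s1: "\<And>a b. 0 \<le> a \<Longrightarrow> a \<le> b \<Longrightarrow> b \<le> 1 \<Longrightarrow> dist (g1 a) (g1 b) \<le> s1 b - s1 a"
    and s2: "\<And>a b. 0 \<le> a \<Longrightarrow> a \<le> b \<Longrightarrow> b \<le> 1 \<Longrightarrow> dist (g2 a) (g2 b) \<le> s2 b - s2 a"
    and joint: "g1 1 = g2 0"
    and ab: "0 \<le> a" "a \<le> b" "b \<le> 1"
  defines "s \<equiv> \<lambda>t. if t \<le> 1/2 then s1 (2 * t) else s1 1 + s2 (2 * t - 1) - s2 0"
  shows "dist ((g1 +++ g2) a) ((g1 +++ g2) b) \<le> s b - s a"
proof -
  consider "b \<le> 1/2" | "a \<le> 1/2" "b > 1/2" | "a > 1/2" by linarith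
  then show ?thesis
  proof cases
    case 1
    then show ?thesis using s1[of "2 * a" "2 * b"] ab by (simp add: joinpaths_def s_def)
  next
    case 2
    have "dist (g1 (2 * a)) (g2 (2 * b - 1)) \<le> dist (g1 (2 * a)) (g1 1) + dist (g2 0) (g2 (2 * b - 1))"
      using dist_triangle[of "g1 (2 * a)" "g2 (2 * b - 1)" "g1 1"] joint by simp
    then show ?thesis using 2 s1[of "2 * a" 1] s2[of 0 "2 * b - 1"] ab
      by (simp add: joinpaths_def s_def)
  next
    case 3
    then show ?thesis using s2[of "2 * a - 1" "2 * b - 1"] ab
      by (simp add: joinpaths_def s_def)
  qed
qed

lemma pathstart_polygonal_path [simp]: "pathstart (polygonal_path (a # zs)) = a"
  by (induction "a # zs" rule: polygonal_path.induct) auto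

lemma pathfinish_polygonal_path: "zs \<noteq> [] \<Longrightarrow> pathfinish (polygonal_path zs) = last zs"
  by (induction zs rule: polygonal_path.induct) auto

lemma path_polygonal_path: "path (polygonal_path zs)"
proof (induction zs rule: polygonal_path.induct)
  case 1
  show ?case unfolding polygonal_path.simps by (rule path_linepath)
next
  case (2 a)
  show ?case unfolding polygonal_path.simps by (rule path_linepath)
qed auto

lemma path_image_polygonal_path:
  "path_image (polygonal_path (a # b # c # zs)) =
    closed_segment a b \<union> path_image (polygonal_path (b # c # zs))"
  by (simp add: path_image_join)

lemma dist_linepath: "a \<le> b \<Longrightarrow> dist (linepath p q a) (linepath p q b) = (b - a) * dist p q"
proof -
  assume "a \<le> b"
  have "linepath p q a - linepath p q b = (b - a) *\<^sub>R (p - q)"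
    by (simp add: linepath_def algebra_simps)
  thus ?thesis using \<open>a \<le> b\<close> by (simp add: dist_norm)
qed

text \<open>The existential form suits the induction: every join halves the parameter intervals, and
  \<open>rectifiable_join\<close> builds the new arc length function from the old one.\<close>

lemma polygonal_path_arc_length:
  "\<exists>s. s 1 - s 0 = polygon_length zs \<and> (\<forall>a b. 0 \<le> a \<longrightarrow> a \<le> b \<longrightarrow> b \<le> 1 \<longrightarrow>
    dist (polygonal_path zs a) (polygonal_path zs b) \<le> s b - s a)"
proof (induction zs rule: polygonal_path.induct)
  case (3 p q)
  show ?case
    by (rule exI[of _ "\<lambda>t. t * dist p q"]) (auto simp: dist_linepath algebra_simps)
next
  case (4 p q r zs)
  then obtain s where s: "s 1 - s 0 = polygon_length (q # r # zs)"
    "\<And>a b. 0 \<le> a \<Longrightarrow> a \<le> b \<Longrightarrow> b \<le> 1 \<Longrightarrow>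
      dist (polygonal_path (q # r # zs) a) (polygonal_path (q # r # zs) b) \<le> s b - s a"
    by blast
  have j: "linepath p q 1 = polygonal_path (q # r # zs) 0"
    using pathstart_polygonal_path[of q "r # zs"] by (simp add: pathstart_def linepath_def)
  have l: "dist (linepath p q a) (linepath p q b) \<le> b * dist p q - a * dist p q" if "a \<le> b" for a b
    using that by (simp add: dist_linepath algebra_simps)
  show ?case
    by (rule exI[of _ "\<lambda>t. if t \<le> 1/2 then 2 * t * dist p q
          else 1 * dist p q + s (2 * t - 1) - s 0"])
      (use rectifiable_join[of "linepath p q" "\<lambda>t. t * dist p q" "polygonal_path (q # r # zs)" s,
          OF l s(2) j] s(1) in \<open>auto\<close>)
qed (auto simp: linepath_def intro: exI[of _ "\<lambda>_. 0"])

lemma path_length_polygonal_path: "path_length (polygonal_path zs) \<le> ennreal (polygon_length zs)"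
proof -
  obtain s where "s 1 - s 0 = polygon_length zs" "\<And>a b. 0 \<le> a \<Longrightarrow> a \<le> b \<Longrightarrow> b \<le> 1 \<Longrightarrow>
      dist (polygonal_path zs a) (polygonal_path zs b) \<le> s b - s a"
    using polygonal_path_arc_length by blast
  thus ?thesis using path_length_le[of "polygonal_path zs" s] by simp
qed

section \<open>Total curvature and the turning angles\<close>

lemma total_curvature_Cons:
  "total_curvature (a # b # c # zs) = pi - angle a b c + total_curvature (b # c # zs)"
proof -
  have "total_curvature (a # b # c # zs) =
    (\<Sum>i\<in>{0..<Suc (length zs)}. pi - angle ((a # b # c # zs) ! i) ((b # c # zs) ! i) ((c # zs) ! i))"
    unfolding total_curvature_def
    by (rule sum.reindex_bij_witness[of _ Suc "\<lambda>i. i - 1"]) (auto simp: nth_Cons')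
  also have "\<dots> = pi - angle a b c +
    (\<Sum>i\<in>{0..<length zs}. pi - angle ((b # c # zs) ! i) ((c # zs) ! i) (zs ! i))"
    by (subst sum.atLeast0_lessThan_Suc_shift) simp
  also have "(\<Sum>i\<in>{0..<length zs}. pi - angle ((b # c # zs) ! i) ((c # zs) ! i) (zs ! i))
      = total_curvature (b # c # zs)"
    unfolding total_curvature_def
    by (rule sum.reindex_bij_witness[of _ "\<lambda>i. i - 1" Suc]) (auto simp: nth_Cons')
  finally show ?thesis .
qed

lemma total_curvature_short [simp]: "total_curvature [a, b] = 0"
  by (simp add: total_curvature_def)

text \<open>Otherwise comparing cosines of \<open>A + B\<close> and \<open>pi - C\<close> gives
  \<open>sin A * sin B \<le> 79/117\<close>. The squares refute this by a small margin: 40/81 =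
  6760/13689 against 6241/13689.\<close>

lemma arccos_sum_gt_pi: "arccos (1/3) + arccos (2/3) + arccos (53/117) > pi"
proof (rule ccontr)
  assume *: "\<not> ?thesis"
  define A B C :: real where "A = arccos (1/3)" and "B = arccos (2/3)" and "C = arccos (53/117)"
  have ge: "0 \<le> A" "0 \<le> B" "0 \<le> C" unfolding A_def B_def C_def by (auto intro!: arccos_lbound)
  have "cos (pi - C) \<le> cos (A + B)"
    using * ge unfolding A_def[symmetric] B_def[symmetric] C_def[symmetric]
    by (intro cos_monotone_0_pi_le) auto
  moreover have "cos (pi - C) = - 53/117" by (simp add: C_def cos_diff)
  moreover have "cos (A + B) = 2/9 - sin A * sin B" by (simp add: A_def B_def cos_add)
  ultimately have "sin A * sin B \<le> 79/117" by simp
  moreover have "0 \<le> sin A * sin B"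
    unfolding A_def B_def by (intro mult_nonneg_nonneg sin_ge_zero) (auto intro: arccos_ubound arccos_lbound)
  ultimately have "(sin A * sin B)\<^sup>2 \<le> (79/117)\<^sup>2" by (intro power_mono)
  moreover have "(sin A)\<^sup>2 = 8/9" "(sin B)\<^sup>2 = 5/9"
    by (simp_all add: sin_squared_eq A_def B_def power_divide)
  ultimately show False by (simp add: power_mult_distrib power_divide)
qed

subsection \<open>The calibration on one half of the surface\<close>

abbreviation point :: "real \<Rightarrow> real \<Rightarrow> real \<Rightarrow> real ^ 3" where
  "point a b c \<equiv> vector [a, b, c]"

lemma vec3_eq_iff: "p = q \<longleftrightarrow> p $ 1 = q $ 1 \<and> p $ 2 = q $ 2 \<and> p $ 3 = (q :: real ^ 3) $ 3"
  by (simp add: vec_eq_iff forall_3)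

lemma dist_vec3: "dist p (q :: real ^ 3)
    = sqrt ((p $ 1 - q $ 1)\<^sup>2 + (p $ 2 - q $ 2)\<^sup>2 + (p $ 3 - q $ 3)\<^sup>2)"
  by (simp add: dist_vec_def L2_set_def sum_3 dist_real_def)

lemma linear_le_dist:
  fixes p q :: "real ^ 3"
  assumes "a\<^sup>2 + b\<^sup>2 + c\<^sup>2 \<le> 1"
  shows "\<bar>a * (p $ 1 - q $ 1) + b * (p $ 2 - q $ 2) + c * (p $ 3 - q $ 3)\<bar> \<le> dist p q"
proof -
  have "norm (point a b c) \<le> 1"
    using assms by (simp add: norm_vec_def L2_set_def sum_3)
  moreover have "\<bar>point a b c \<bullet> (p - q)\<bar> \<le> norm (point a b c) * dist p q"
    using Cauchy_Schwarz_ineq2 by (simp add: dist_norm)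
  ultimately have "\<bar>point a b c \<bullet> (p - q)\<bar> \<le> dist p q"
    using mult_right_mono[of "norm (point a b c)" 1 "dist p q"] by simp
  thus ?thesis by (simp add: inner_vec_def sum_3)
qed

text \<open>The equality case of Cauchy-Schwarz for a unit vector \<open>w\<close>.\<close>

lemma parallel_if_inner_eq_norm:
  fixes v w :: "'a::real_inner"
  assumes "norm w = 1" and "\<bar>w \<bullet> v\<bar> = norm v"
  shows "v = (w \<bullet> v) *\<^sub>R w"
proof -
  have w: "w \<bullet> w = 1" using assms(1) by (simp add: dot_square_norm)
  have "(w \<bullet> v)\<^sup>2 = v \<bullet> v" using assms(2) by (metis dot_square_norm power2_abs)
  hence "(v - (w \<bullet> v) *\<^sub>R w) \<bullet> (v - (w \<bullet> v) *\<^sub>R w) = 0"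
    by (simp add: inner_diff inner_commute w power2_eq_square)
  thus ?thesis by simp
qed

datatype face = Bottom | Side | Bevel | Roof

text \<open>Positive outside the half-space of the face and zero on its plane. The outward normals
  of side, bevel and roof have the integer lengths 75, 225 and 325.\<close>

fun excess :: "face \<Rightarrow> real ^ 3 \<Rightarrow> real" where
  "excess Bottom p = - p $ 3"
| "excess Side p = 70 * p $ 1 + 14 * p $ 2 - 23 * p $ 3 - 2800000"
| "excess Bevel p = 140 * p $ 1 - 152 * p $ 2 + 89 * p $ 3 - 5618000"
| "excess Roof p = 35 * p $ 1 + 84 * p $ 2 + 312 * p $ 3 - 1442320"

fun normal :: "face \<Rightarrow> real ^ 3" where
  "normal Bottom = point 0 0 (-1)"
| "normal Side = point 70 14 (-23)"
| "normal Bevel = point 140 (-152) 89"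
| "normal Roof = point 35 84 312"

fun offset :: "face \<Rightarrow> real" where
  "offset Bottom = 0"
| "offset Side = 2800000"
| "offset Bevel = 5618000"
| "offset Roof = 1442320"

lemma excess_eq: "excess f p = normal f \<bullet> p - offset f"
  by (cases f) (simp_all add: inner_vec_def sum_3)

definition half_face :: "face \<Rightarrow> (real ^ 3) set" where
  "half_face f = {p. 0 \<le> p $ 1 \<and> excess f p = 0 \<and> (\<forall>g. excess g p \<le> 0)}"

lemma UNIV_face: "UNIV = {Bottom, Side, Bevel, Roof}"
  using face.exhaust by auto

lemma all_face: "(\<forall>f. P f) \<longleftrightarrow> P Bottom \<and> P Side \<and> P Bevel \<and> P Roof"
  by (metis face.exhaust)

lemma half_faceD:
  assumes "p \<in> half_face f"
  shows "0 \<le> p $ 1" "excess f p = 0" "0 \<le> p $ 3"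
    "70 * p $ 1 + 14 * p $ 2 - 23 * p $ 3 \<le> 2800000"
    "140 * p $ 1 - 152 * p $ 2 + 89 * p $ 3 \<le> 5618000"
    "35 * p $ 1 + 84 * p $ 2 + 312 * p $ 3 \<le> 1442320"
  using assms by (auto simp: half_face_def all_face)

text \<open>The path on the side \<open>x \<ge> 0\<close> starts at the origin, crosses each face once, and runs on face \<open>f\<close>
  from \<open>node f\<close> to \<open>node_after f\<close>; \<open>arclen f\<close> is the length covered before \<open>node f\<close>.\<close>

fun node :: "face \<Rightarrow> real ^ 3" where
  "node Bottom = 0"
| "node Side = point 40000 0 0"
| "node Bevel = point 40040 (-16) 112"
| "node Roof = point 40028 (-13) 136"

fun node_after :: "face \<Rightarrow> real ^ 3" where
  "node_after Bottom = node Side"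
| "node_after Side = node Bevel"
| "node_after Bevel = node Roof"
| "node_after Roof = point 40016 (-8) 136"

fun direction :: "face \<Rightarrow> real ^ 3" where
  "direction Bottom = point 1 0 0"
| "direction Side = point (1/3) (-2/15) (14/15)"
| "direction Bevel = point (-4/9) (1/9) (8/9)"
| "direction Roof = point (-12/13) (5/13) 0"

fun arclen :: "face \<Rightarrow> real" where
  "arclen Bottom = 0"
| "arclen Side = 40000"
| "arclen Bevel = 40120"
| "arclen Roof = 40147"

fun leg :: "face \<Rightarrow> real" where
  "leg Bottom = 40000"
| "leg Side = 120"
| "leg Bevel = 27"
| "leg Roof = 13"

definition main :: "face \<Rightarrow> real ^ 3 \<Rightarrow> real" where
  "main f p = arclen f + direction f \<bullet> (p - node f)"

text \<open>On face \<open>f\<close>, the distance along the surface to the plane \<open>x = 0\<close> is at least the minimum of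
  \<open>main f\<close>, which continues the distance along the path, and \<open>detour f\<close>, which accounts for routes
  through other faces. The linear functions making up \<open>detour\<close> are chosen to agree on an edge with a
  function of the adjacent face: \<open>x + z\<close> and \<open>x + 2 z\<close> with \<open>x\<close> on the edges of the bottom, the two
  with \<open>excess\<close> on the edges of the roof with the bevel and the side. The last one, \<open>201/200 x\<close>, can
  exceed \<open>x\<close> because of the slope of the roof. Bottom and side need no detour, hence the dummy
  summand 1.\<close>

fun detour :: "face \<Rightarrow> real ^ 3 \<Rightarrow> real" where
  "detour Bottom p = main Bottom p + 1"
| "detour Side p = main Side p + 1"
| "detour Bevel p = min (p $ 1 + p $ 3) (201/200 * p $ 1)"
| "detour Roof p = min
    (min (p $ 1 + p $ 3 - excess Bevel p / 150) (main Side p - excess Side p / 75))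
    (min (p $ 1 + 2 * p $ 3) (201/200 * p $ 1))"

definition height :: "face \<Rightarrow> real ^ 3 \<Rightarrow> real" where
  "height f p = min (main f p) (detour f p)"

lemma main_simps:
  "main Bottom p = p $ 1"
  "main Side p = 40000 + (5 * (p $ 1 - 40000) - 2 * p $ 2 + 14 * p $ 3) / 15"
  "main Bevel p = 40120 + (- 4 * (p $ 1 - 40040) + (p $ 2 + 16) + 8 * (p $ 3 - 112)) / 9"
  "main Roof p = 40147 + (- 12 * (p $ 1 - 40028) + 5 * (p $ 2 + 13)) / 13"
  by (simp_all add: main_def inner_vec_def sum_3 field_simps)

lemma norm_direction [simp]: "norm (direction f) = 1"
  by (cases f) (simp_all add: norm_vec_def L2_set_def sum_3 power2_eq_square)

lemma leg_pos: "0 < leg f"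
  by (cases f) auto

lemma node_after_eq: "node_after f = node f + leg f *\<^sub>R direction f"
  by (cases f) (simp_all add: vec3_eq_iff)

lemma height_Bottom: "height Bottom p = p $ 1"
  by (simp add: height_def main_simps)

lemma height_Side: "height Side p = main Side p"
  by (simp add: height_def)

text \<open>Between consecutive faces the two \<open>main\<close> functions agree, because the path
  unfolds to a straight line across the edge. For the other pairs the minimum is attained by the
  term of \<open>detour\<close> fitted to that edge. The remaining half-spaces supply the
  inequalities against the other terms.\<close>

lemma height_consistent:
  assumes "p \<in> half_face f" and "p \<in> half_face g"
  shows "height f p = height g p"
proof -
  have BS: "height Bottom p = height Side p" if "excess Bottom p = 0" "excess Side p = 0"
    using that by (simp add: height_Bottom height_Side main_simps field_simps)
  have BV: "height Bottom p = height Bevel p" if "excess Bottom p = 0" "excess Bevel p = 0"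
  proof -
    have "p $ 1 \<le> main Bevel p"
      using that half_faceD[OF assms(1)] by (simp add: main_simps field_simps)
    thus ?thesis using that half_faceD(1)[OF assms(1)] by (simp add: height_def main_simps(1))
  qed
  have BR: "height Bottom p = height Roof p" if "excess Bottom p = 0" "excess Roof p = 0"
  proof -
    have "p $ 1 \<le> main Roof p" "p $ 1 \<le> p $ 1 - excess Bevel p / 150"
      "p $ 1 \<le> main Side p - excess Side p / 75"
      using that half_faceD[OF assms(1)] by (simp_all add: main_simps field_simps)
    thus ?thesis using that half_faceD(1)[OF assms(1)] by (simp add: height_def main_simps(1))
  qed
  have SV: "height Side p = height Bevel p" if "excess Side p = 0" "excess Bevel p = 0"
  proof -
    have "main Side p = main Bevel p" "main Side p \<le> p $ 1 + p $ 3" "main Side p \<le> 201/200 * p $ 1"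
      using that half_faceD[OF assms(1)] by (simp_all add: main_simps field_simps)
    thus ?thesis by (simp add: height_def)
  qed
  have SR: "height Side p = height Roof p" if "excess Side p = 0" "excess Roof p = 0"
  proof -
    have "main Side p \<le> main Roof p" "main Side p \<le> p $ 1 + p $ 3 - excess Bevel p / 150"
      "main Side p \<le> p $ 1 + 2 * p $ 3" "main Side p \<le> 201/200 * p $ 1"
      using that half_faceD[OF assms(1)] by (simp_all add: main_simps field_simps)
    thus ?thesis using that(1) by (simp add: height_def del: excess.simps)
  qed
  have VR: "height Bevel p = height Roof p" if "excess Bevel p = 0" "excess Roof p = 0"
  proof -
    have "main Bevel p = main Roof p" "main Bevel p \<le> main Side p - excess Side p / 75"
      "min (main Bevel p) (201/200 * p $ 1) \<le> p $ 1 + 2 * p $ 3"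
      using that half_faceD[OF assms(1)] by (simp_all add: main_simps field_simps min_def)
    thus ?thesis using that(1) unfolding height_def detour.simps by linarith
  qed
  show ?thesis
    using half_faceD(2)[OF assms(1)] half_faceD(2)[OF assms(2)] BS BV BR SV SR VR
    by (cases f; cases g) (simp_all del: excess.simps)
qed


lemma abs_main_diff: "\<bar>main f p - main f q\<bar> \<le> dist p q"
proof -
  have "main f p - main f q = direction f \<bullet> (p - q)"
    by (simp add: main_def inner_diff_right)
  thus ?thesis using Cauchy_Schwarz_ineq2[of "direction f" "p - q"] by (simp add: dist_norm)
qed

lemma abs_detour_diff:
  assumes "p \<in> half_face f" and "q \<in> half_face f"
  shows "\<bar>detour f p - detour f q\<bar> \<le> dist p q"
proof -
  note ex = half_faceD(2)[OF assms(1)] half_faceD(2)[OF assms(2)]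
  have min: "\<bar>min a b - min c d\<bar> \<le> e" if "\<bar>a - c\<bar> \<le> e" "\<bar>b - d\<bar> \<le> e" for a b c d e :: real
    using that by linarith
  \<comment> \<open>Only the tangential part of a gradient counts; \<open>t\<close> removes its normal component.\<close>
  have tangential: "\<bar>u p - u q\<bar> \<le> dist p q"
    if "excess f = (\<lambda>p. k * p $ 1 + l * p $ 2 + m * p $ 3 - n)"
      and "u = (\<lambda>p. a * p $ 1 + b * p $ 2 + c * p $ 3 + d)"
      and "(a - t * k)\<^sup>2 + (b - t * l)\<^sup>2 + (c - t * m)\<^sup>2 \<le> 1"
    for u a b c d k l m n t
  proof -
    have "u p - u q = (a - t * k) * (p $ 1 - q $ 1) + (b - t * l) * (p $ 2 - q $ 2)
        + (c - t * m) * (p $ 3 - q $ 3) + t * (excess f p - excess f q)"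
      unfolding that by (simp add: algebra_simps)
    thus ?thesis using linear_le_dist[OF that(3), of p q] ex by simp
  qed
  show ?thesis
  proof (cases f)
    case Bevel
    have n: "excess f = (\<lambda>p. 140 * p $ 1 + (-152) * p $ 2 + 89 * p $ 3 - 5618000)"
      by (rule ext) (simp add: Bevel)
    show ?thesis unfolding Bevel detour.simps
    proof (rule min)
      \<comment> \<open>The last argument \<open>t\<close> is the inner product of gradient and
        normal over the squared length of the normal, 50625 = 225^2 here and 105625 = 325^2 on the
        roof.\<close>
      show "\<bar>p $ 1 + p $ 3 - (q $ 1 + q $ 3)\<bar> \<le> dist p q"
        using tangential[OF n, of "\<lambda>p. p $ 1 + p $ 3" 1 0 1 0 "229/50625"]
        by (simp add: power2_eq_square)
      show "\<bar>201/200 * p $ 1 - 201/200 * q $ 1\<bar> \<le> dist p q"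
        using tangential[OF n, of "\<lambda>p. 201/200 * p $ 1" "201/200" 0 0 0 "469/168750"]
        by (simp add: power2_eq_square)
    qed
  next
    case Roof
    have n: "excess f = (\<lambda>p. 35 * p $ 1 + 84 * p $ 2 + 312 * p $ 3 - 1442320)"
      by (rule ext) (simp add: Roof)
    show ?thesis unfolding Roof detour.simps
    proof (intro min)
      have u: "(\<lambda>p. p $ 1 + p $ 3 - excess Bevel p / 150)
          = (\<lambda>p. 1/15 * p $ 1 + 76/75 * p $ 2 + 61/150 * p $ 3 + 112360/3)"
        by (rule ext) (simp add: field_simps)
      show "\<bar>p $ 1 + p $ 3 - excess Bevel p / 150 - (q $ 1 + q $ 3 - excess Bevel q / 150)\<bar> \<le> dist p q"
        by (rule tangential[OF n u, of "643/316875"]) (simp add: power2_eq_square)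
      have v: "(\<lambda>p. main Side p - excess Side p / 75)
          = (\<lambda>p. (-3/5) * p $ 1 + (-8/25) * p $ 2 + 31/25 * p $ 3 + 64000)"
        by (rule ext) (simp add: main_simps field_simps)
      show "\<bar>main Side p - excess Side p / 75 - (main Side q - excess Side q / 75)\<bar> \<le> dist p q"
        by (rule tangential[OF n v, of "339/105625"]) (simp add: power2_eq_square)
      show "\<bar>p $ 1 + 2 * p $ 3 - (q $ 1 + 2 * q $ 3)\<bar> \<le> dist p q"
        using tangential[OF n, of "\<lambda>p. p $ 1 + 2 * p $ 3" 1 0 2 0 "659/105625"]
        by (simp add: power2_eq_square)
      show "\<bar>201/200 * p $ 1 - 201/200 * q $ 1\<bar> \<le> dist p q"
        using tangential[OF n, of "\<lambda>p. 201/200 * p $ 1" "201/200" 0 0 0 "1407/4225000"]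
        by (simp add: power2_eq_square)
    qed
  qed (use abs_main_diff in auto)
qed

lemma abs_height_diff:
  assumes "p \<in> half_face f" and "q \<in> half_face f"
  shows "\<bar>height f p - height f q\<bar> \<le> dist p q"
  using abs_main_diff[of f p q] abs_detour_diff[OF assms] unfolding height_def by linarith

section \<open>The legs of the route\<close>

lemma mem_leg_iff:
  "p \<in> closed_segment (node f) (node_after f) \<longleftrightarrow>
    (\<exists>t. 0 \<le> t \<and> t \<le> leg f \<and> p = node f + t *\<^sub>R direction f)" (is "?l \<longleftrightarrow> ?r")
proof
  assume ?l
  then obtain u where u: "0 \<le> u" "u \<le> 1" "p = (1 - u) *\<^sub>R node f + u *\<^sub>R node_after f"
    by (auto simp: in_segment)
  hence "p = node f + (u * leg f) *\<^sub>R direction f"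
    by (simp add: node_after_eq algebra_simps)
  moreover have "u * leg f \<le> leg f" "0 \<le> u * leg f"
    using u leg_pos[of f] mult_right_mono[of u 1 "leg f"] by simp_all
  ultimately show ?r by blast
next
  assume ?r
  then obtain t where t: "0 \<le> t" "t \<le> leg f" "p = node f + t *\<^sub>R direction f" by blast
  hence "p = (1 - t / leg f) *\<^sub>R node f + (t / leg f) *\<^sub>R node_after f"
    using leg_pos[of f] by (simp add: node_after_eq algebra_simps)
  moreover have "0 \<le> t / leg f" "t / leg f \<le> 1" using t leg_pos[of f] by simp_all
  ultimately show ?l unfolding in_segment by blast
qed

lemma main_on_leg: "main f (node f + t *\<^sub>R direction f) = arclen f + t"
  by (simp add: main_def dot_square_norm)

definition half_route :: "(real ^ 3) set" where
  "half_route = (\<Union>f. closed_segment (node f) (node_after f))"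

lemma leg_subset_half_face:
  "closed_segment (node f) (node_after f) \<subseteq> half_face f"
proof
  fix p assume "p \<in> closed_segment (node f) (node_after f)"
  then obtain t where "0 \<le> t" "t \<le> leg f" "p = node f + t *\<^sub>R direction f"
    unfolding mem_leg_iff by blast
  thus "p \<in> half_face f"
    by (cases f) (auto simp: half_face_def all_face field_simps)
qed

text \<open>Strictness excludes that a chord ending on the route is tight by way of a
  detour.\<close>

lemma main_less_detour:
  assumes "p \<in> closed_segment (node f) (node_after f)"
  shows "main f p < detour f p"
proof -
  obtain t where "0 \<le> t" "t \<le> leg f" "p = node f + t *\<^sub>R direction f"
    using assms unfolding mem_leg_iff by blast
  thus ?thesis by (cases f) (simp_all add: main_simps field_simps)
qed

text \<open>Along a leg, the \<open>excess\<close> of another face vanishes only at a node that this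
  leg shares with the leg of that face.\<close>

lemma half_route_Int_half_face:
  assumes "p \<in> half_route" and "p \<in> half_face f"
  shows "p \<in> closed_segment (node f) (node_after f)"
proof -
  obtain g where g: "p \<in> closed_segment (node g) (node_after g)"
    using assms(1) by (auto simp: half_route_def)
  then obtain t where t: "0 \<le> t" "t \<le> leg g" "p = node g + t *\<^sub>R direction g"
    unfolding mem_leg_iff by blast
  have ends: "node f \<in> closed_segment (node f) (node_after f)"
    "node_after f \<in> closed_segment (node f) (node_after f)" by auto
  have "excess f p = 0" using half_faceD(2)[OF assms(2)] .
  with t have "f = g \<or> p = node f \<or> p = node_after f"
    by (cases f; cases g) (simp_all add: vec3_eq_iff)
  thus ?thesis using g ends by auto
qed

subsection \<open>Reflection in the symmetry plane\<close>

text \<open>This makes the odd extension across the symmetry plane consistent. On bevel and roof the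
  term \<open>201/200 * p $ 1\<close> vanishes and the other terms are nonnegative; the side does
  not reach the plane.\<close>

lemma height_eq_0:
  assumes "p \<in> half_face f" and "p $ 1 = 0"
  shows "height f p = 0"
  using half_faceD[OF assms(1)] assms(2)
  by (cases f) (auto simp: height_def main_simps field_simps min_def)

text \<open>Since \<open>detour\<close> is 1-Lipschitz and exceeds \<open>main\<close> at
  \<open>q\<close>, equality forces the branch \<open>main\<close> at \<open>p\<close> as well.
  Equality in Cauchy-Schwarz then puts \<open>p\<close> on the line of the leg. The inequalities of
  the face confine it to the leg, except at the far end of the roof leg, which lies inside the face
  and is cut off by \<open>le\<close>.\<close>

lemma tight_in_half_face:
  assumes p: "p \<in> half_face f" and q: "q \<in> half_face f" "q \<in> half_route"
    and tight: "dist p q = \<bar>height f p - height f q\<bar>" and le: "height f p \<le> 40160"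
  shows "p \<in> half_route"
proof -
  have q': "q \<in> closed_segment (node f) (node_after f)"
    by (rule half_route_Int_half_face[OF q(2,1)])
  have qm: "height f q = main f q" "main f q < detour f q"
    using main_less_detour[OF q'] by (simp_all add: height_def)
  have "height f p = main f p" and eq: "\<bar>main f p - main f q\<bar> = dist p q"
    using tight qm abs_main_diff[of f p q] abs_detour_diff[OF p q(1)]
    unfolding height_def by linarith+
  obtain t where t: "0 \<le> t" "t \<le> leg f" "q = node f + t *\<^sub>R direction f"
    using q' unfolding mem_leg_iff by blast
  have "main f p - main f q = direction f \<bullet> (p - q)"
    by (simp add: main_def inner_diff_right)
  hence par: "p - q = (direction f \<bullet> (p - q)) *\<^sub>R direction f"
    using eq by (intro parallel_if_inner_eq_norm) (auto simp: dist_norm)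
  define s where "s = t + direction f \<bullet> (p - q)"
  have "p = q + (p - q)" by simp
  also have "\<dots> = node f + s *\<^sub>R direction f"
    by (subst par) (simp add: t(3) s_def scaleR_add_left add.assoc)
  finally have s: "p = node f + s *\<^sub>R direction f" .
  have "arclen f + s \<le> 40160"
    using le \<open>height f p = main f p\<close> unfolding s main_on_leg by simp
  moreover note half_faceD[OF p]
  ultimately have "0 \<le> s \<and> s \<le> leg f"
    unfolding s by (cases f) (auto simp: field_simps)
  hence "p \<in> closed_segment (node f) (node_after f)" unfolding mem_leg_iff using s by blast
  thus ?thesis by (auto simp: half_route_def)
qed

text \<open>By \<open>height_consistent\<close> the choice of the face is immaterial.\<close>

definition half_height :: "real ^ 3 \<Rightarrow> real" where
  "half_height p = height (SOME f. p \<in> half_face f) p"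

lemma half_height_eq: "p \<in> half_face f \<Longrightarrow> half_height p = height f p"
  unfolding half_height_def by (metis height_consistent someI)

text \<open>The arc length parametrization of the half route, inverse to \<open>half_height\<close>
  there.\<close>

fun place :: "real \<Rightarrow> real ^ 3" where
  "place s = (if s \<le> 40000 then node Bottom + s *\<^sub>R direction Bottom
    else if s \<le> 40120 then node Side + (s - 40000) *\<^sub>R direction Side
    else if s \<le> 40147 then node Bevel + (s - 40120) *\<^sub>R direction Bevel
    else node Roof + (s - 40147) *\<^sub>R direction Roof)"

lemma half_route_place:
  assumes "p \<in> half_route"
  shows "0 \<le> half_height p" "half_height p \<le> 40160" "place (half_height p) = p"
proof -
  obtain f where f: "p \<in> closed_segment (node f) (node_after f)"
    using assms by (auto simp: half_route_def)
  then obtain t where t: "0 \<le> t" "t \<le> leg f" "p = node f + t *\<^sub>R direction f"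
    unfolding mem_leg_iff by blast
  have "half_height p = main f p"
    using half_height_eq[of p f] f leg_subset_half_face[of f] main_less_detour[OF f]
    by (auto simp: height_def)
  hence h: "half_height p = arclen f + t" unfolding t(3) main_on_leg .
  show "0 \<le> half_height p" "half_height p \<le> 40160" "place (half_height p) = p"
    unfolding h using t by (cases f; auto simp: vec3_eq_iff)+
qed

definition reflect :: "real ^ 3 \<Rightarrow> real ^ 3" where
  "reflect p = point (- p $ 1) (p $ 2) (p $ 3)"

lemma reflect_simps [simp]:
  "reflect p $ 1 = - p $ 1" "reflect p $ 2 = p $ 2" "reflect p $ 3 = p $ 3"
  by (simp_all add: reflect_def)

lemma reflect_reflect [simp]: "reflect (reflect p) = p"
  by (simp add: vec3_eq_iff)

lemma dist_reflect [simp]: "dist (reflect p) (reflect q) = dist p q"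
  by (simp add: dist_vec3 power2_commute)

lemma linear_reflect: "linear reflect"
  by (auto intro!: linearI simp: vec3_eq_iff)

lemma reflect_closed_segment:
  "reflect ` closed_segment a b = closed_segment (reflect a) (reflect b)"
  using closed_segment_linear_image[OF linear_reflect] by metis

lemma mem_reflect_image: "p \<in> reflect ` S \<longleftrightarrow> reflect p \<in> S"
  by (metis image_iff reflect_reflect)

text \<open>The extension is odd, so that the function increases along the whole path from one end
  to the other.\<close>

definition signed_height :: "real ^ 3 \<Rightarrow> real" where
  "signed_height p = (if 0 \<le> p $ 1 then half_height p else - half_height (reflect p))"

lemma signed_height_half_face: "p \<in> half_face f \<Longrightarrow> signed_height p = height f p"
  using half_height_eq half_faceD(1) by (auto simp: signed_height_def)

lemma signed_height_reflect:
  assumes "p \<in> half_face f"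
  shows "signed_height (reflect p) = - height f p"
proof (cases "p $ 1 = 0")
  case True
  hence "reflect p = p" by (simp add: vec3_eq_iff)
  thus ?thesis using height_eq_0[OF assms True] signed_height_half_face[OF assms] by simp
next
  case False
  thus ?thesis using half_height_eq[OF assms] half_faceD(1)[OF assms]
    by (simp add: signed_height_def)
qed

text \<open>Faces meeting the symmetry plane are cut there, so that one sign of the height applies
  on each piece.\<close>

definition pieces :: "(real ^ 3) set set" where
  "pieces = range half_face \<union> range (\<lambda>f. reflect ` half_face f)"

lemma continuous_on_excess: "continuous_on S (excess f)"
proof -
  have "excess f = (\<lambda>p. normal f \<bullet> p - offset f)" by (rule ext) (rule excess_eq)
  thus ?thesis by (simp add: continuous_intros)
qed

lemma closed_half_face: "closed (half_face f)"
proof -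
  have "half_face f = {p. 0 \<le> p $ 1} \<inter> {p. excess f p = 0} \<inter> (\<Inter>g. {p. excess g p \<le> 0})"
    by (auto simp: half_face_def)
  thus ?thesis
    by (auto intro!: closed_Int closed_INT closed_Collect_le closed_Collect_eq
        continuous_intros continuous_on_excess)
qed

lemma finite_face: "finite (UNIV :: face set)"
  by (simp add: UNIV_face)

interpretation surface: calibration pieces signed_height
proof
  show "finite pieces" using finite_face by (simp add: pieces_def)
  have "closed (reflect ` half_face f)" for f
  proof -
    have "reflect ` half_face f = reflect -` half_face f"
      by (auto simp: mem_reflect_image)
    moreover have "continuous_on UNIV reflect"
      using linear_continuous_on linear_reflect linear_conv_bounded_linear by blast
    ultimately show ?thesis using closed_half_face closed_vimage by metis
  qed
  thus "closed F" if "F \<in> pieces" for F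
    using that closed_half_face by (auto simp: pieces_def)
  show "\<bar>signed_height p - signed_height q\<bar> \<le> dist p q" if F: "F \<in> pieces" "p \<in> F" "q \<in> F" for F p q
  proof -
    have minus: "\<bar>signed_height (reflect p) - signed_height (reflect q)\<bar> \<le> dist p q"
      if "p \<in> half_face f" "q \<in> half_face f" for p q f
      using abs_height_diff[OF that] signed_height_reflect[OF that(1)] signed_height_reflect[OF that(2)]
      by simp
    show ?thesis using F minus abs_height_diff signed_height_half_face
      by (fastforce simp: pieces_def)
  qed
qed

section \<open>The route on both sides of the symmetry plane\<close>

definition route :: "(real ^ 3) set" where
  "route = half_route \<union> reflect ` half_route"

lemma half_route_half_face: "p \<in> half_route \<Longrightarrow> \<exists>f. p \<in> half_face f"
  using leg_subset_half_face by (auto simp: half_route_def)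

lemma half_route_nonneg: "p \<in> half_route \<Longrightarrow> 0 \<le> p $ 1"
  using half_route_half_face half_faceD(1) by blast

lemma route_Int_nonneg:
  assumes "p \<in> route" and "0 \<le> p $ 1"
  shows "p \<in> half_route"
proof (rule ccontr)
  assume "p \<notin> half_route"
  hence "reflect p \<in> half_route" using assms(1) by (simp add: route_def mem_reflect_image)
  hence "p $ 1 = 0" using half_route_nonneg[of "reflect p"] assms(2) by simp
  hence "reflect p = p" by (simp add: vec3_eq_iff)
  thus False using \<open>reflect p \<in> half_route\<close> \<open>p \<notin> half_route\<close> by simp
qed

lemma reflect_route: "reflect p \<in> route \<longleftrightarrow> p \<in> route"
  by (auto simp: route_def mem_reflect_image)

text \<open>The bound 40160 required by \<open>tight_in_half_face\<close> comes from
  \<open>q\<close> for \<open>x \<ge> 0\<close>. On the reflected side the height decreases towards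
  \<open>q\<close>, and the bound comes from \<open>ge\<close>.\<close>

lemma tight_step:
  assumes "surface.linked p q" and "q \<in> route"
    and tight: "dist p q = signed_height q - signed_height p"
    and ge: "- 40160 \<le> signed_height p"
  shows "p \<in> route"
proof -
  from assms(1) have "\<exists>F\<in>pieces. p \<in> F \<and> q \<in> F" unfolding surface.linked_def .
  then consider f where "p \<in> half_face f" "q \<in> half_face f"
    | f where "reflect p \<in> half_face f" "reflect q \<in> half_face f"
    by (auto simp: pieces_def mem_reflect_image)
  then show ?thesis
  proof cases
    case 1
    have qr: "q \<in> half_route"
      using route_Int_nonneg[OF assms(2)] half_faceD(1)[OF 1(2)] by simp
    have eq: "dist p q = height f q - height f p"
      using tight 1 by (simp add: signed_height_half_face)
    have "height f q \<le> 40160" using half_route_place(2)[OF qr] half_height_eq[OF 1(2)] by simp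
    hence "p \<in> half_route"
      using eq zero_le_dist[of p q] by (intro tight_in_half_face[OF 1 qr]) auto
    thus ?thesis by (simp add: route_def)
  next
    case 2
    have qr: "reflect q \<in> half_route"
      using route_Int_nonneg[of "reflect q"] assms(2) half_faceD(1)[OF 2(2)] by (simp add: reflect_route)
    have s: "signed_height p = - height f (reflect p)" "signed_height q = - height f (reflect q)"
      using signed_height_reflect[OF 2(1)] signed_height_reflect[OF 2(2)] by simp_all
    have "dist (reflect p) (reflect q) = height f (reflect p) - height f (reflect q)"
      using tight s by simp
    hence "reflect p \<in> half_route"
      using ge s zero_le_dist[of p q] by (intro tight_in_half_face[OF 2 qr]) auto
    thus ?thesis by (simp add: route_def mem_reflect_image)
  qed
qed

lemma signed_height_half_route:
  assumes "p \<in> half_route"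
  shows "signed_height p = half_height p" "signed_height (reflect p) = - half_height p"
proof -
  obtain f where "p \<in> half_face f" using half_route_half_face[OF assms] by blast
  thus "signed_height p = half_height p" "signed_height (reflect p) = - half_height p"
    using signed_height_half_face signed_height_reflect half_height_eq by auto
qed

lemma inj_on_signed_height: "inj_on signed_height route"
proof -
  define Place where "Place s = (if 0 \<le> s then place s else reflect (place (- s)))" for s
  have "Place (signed_height p) = p" if "p \<in> route" for p
  proof (cases "0 \<le> p $ 1")
    case True
    hence "p \<in> half_route" using that route_Int_nonneg by blast
    thus ?thesis using half_route_place signed_height_half_route(1) by (simp add: Place_def)
  next
    case False
    hence r: "reflect p \<in> half_route"
      using route_Int_nonneg[of "reflect p"] that by (simp add: reflect_route)
    have "signed_height p = - half_height (reflect p)"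
      using signed_height_half_route(2)[OF r] by simp
    \<comment> \<open>The value 0 would fall under the first branch of \<open>Place\<close>.\<close>
    moreover have "half_height (reflect p) \<noteq> 0"
    proof
      assume "half_height (reflect p) = 0"
      hence "reflect p = place 0" using half_route_place(3)[OF r] by simp
      thus False using False by (simp add: vec3_eq_iff)
    qed
    ultimately show ?thesis using half_route_place[OF r] by (simp add: Place_def)
  qed
  thus ?thesis by (rule inj_on_inverseI)
qed

subsection \<open>The polyhedron\<close>

definition body :: "(real ^ 3) set" where
  "body = {p. \<forall>f. excess f p \<le> 0 \<and> excess f (reflect p) \<le> 0}"

lemma reflect_body: "reflect p \<in> body \<longleftrightarrow> p \<in> body"
  by (auto simp: body_def)

text \<open>No \<open>excess\<close> has a negative coefficient at \<open>p $ 1\<close>, so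
  reflecting a point with \<open>x \<ge> 0\<close> cannot raise it.\<close>

lemma body_iff_nonneg:
  assumes "0 \<le> p $ 1"
  shows "p \<in> body \<longleftrightarrow> (\<forall>f. excess f p \<le> 0)"
  using assms by (auto simp: body_def all_face)

lemma polyhedron_body: "polyhedron body"
proof -
  have "{p. excess f p \<le> 0} = {p. normal f \<bullet> p \<le> offset f}"
    and "{p. excess f (reflect p) \<le> 0} = {p. reflect (normal f) \<bullet> p \<le> offset f}" for f
    by (simp_all add: excess_eq inner_vec_def sum_3)
  hence P: "polyhedron {p. excess f p \<le> 0}" "polyhedron {p. excess f (reflect p) \<le> 0}" for f
    by (simp_all add: polyhedron_halfspace_le)
  have "body = \<Inter>((\<lambda>f. {p. excess f p \<le> 0} \<inter> {p. excess f (reflect p) \<le> 0}) ` UNIV)"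
    by (auto simp: body_def)
  also have "polyhedron \<dots>"
    by (intro polyhedron_Inter finite_imageI finite_face) (auto intro!: polyhedron_Int P)
  finally show ?thesis .
qed

lemma compact_body: "compact body"
proof -
  have "norm p \<le> 180000" if p: "p \<in> body" for p
  proof -
    have "\<bar>p $ 1\<bar> \<le> 60000" "\<bar>p $ 2\<bar> \<le> 60000" "\<bar>p $ 3\<bar> \<le> 60000"
      using p by (auto simp: body_def all_face abs_le_iff)
    thus ?thesis using norm_le_l1_cart[of p] by (simp add: sum_3)
  qed
  thus ?thesis
    using polyhedron_imp_closed[OF polyhedron_body] by (auto simp: compact_eq_bounded_closed bounded_iff)
qed

lemma interior_body:
  assumes "\<And>f. excess f p < 0" and "\<And>f. excess f (reflect p) < 0"
  shows "p \<in> interior body"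
proof -
  define S where "S = (\<Inter>f. {p. excess f p < 0} \<inter> {p. excess f (reflect p) < 0})"
  have "continuous_on UNIV (\<lambda>p. excess f (reflect p))" for f
    using continuous_on_compose2[OF continuous_on_excess]
      linear_continuous_on linear_reflect linear_conv_bounded_linear by blast
  hence "open S" unfolding S_def
    by (intro open_INT finite_face ballI open_Int open_Collect_less continuous_on_excess) auto
  moreover have "S \<subseteq> body" by (auto simp: S_def body_def intro: less_imp_le)
  moreover have "p \<in> S" using assms by (simp add: S_def)
  ultimately show ?thesis by (meson interiorI)
qed

lemma half_face_if_nonneg:
  assumes "p \<in> body" and "p \<notin> interior body" and "0 \<le> p $ 1"
  shows "\<exists>f. p \<in> half_face f"
proof (rule ccontr)
  assume no: "\<nexists>f. p \<in> half_face f"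
  have le: "excess f p \<le> 0" for f using assms by (simp add: body_def)
  hence "excess f p < 0" for f
    using no assms(3) by (fastforce simp: half_face_def order_less_le)
  moreover have "excess f (reflect p) \<le> excess f p" for f
    using assms(3) by (cases f) auto
  ultimately show False using interior_body[of p] assms(2) order_le_less_trans by blast
qed

lemma reflect_interior: "reflect p \<in> interior body \<longleftrightarrow> p \<in> interior body"
proof -
  have *: "p \<in> interior body" if "reflect p \<in> interior body" for p
  proof -
    obtain e where e: "e > 0" "ball (reflect p) e \<subseteq> body" using \<open>reflect p \<in> interior body\<close> mem_interior by blast
    have "ball p e \<subseteq> body"
    proof
      fix q assume "q \<in> ball p e"
      hence "reflect q \<in> ball (reflect p) e" by simp
      thus "q \<in> body" using e(2) reflect_body by blast
    qed
    thus ?thesis using e(1) mem_interior by blast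
  qed
  from *[of p] *[of "reflect p"] show ?thesis by auto
qed

lemma half_face_subset_frontier: "half_face f \<subseteq> frontier body"
proof
  fix p assume p: "p \<in> half_face f"
  have "p \<in> body" using p by (auto simp: half_face_def body_iff_nonneg)
  moreover have "p \<notin> interior body"
  proof
    assume "p \<in> interior body"
    then obtain e where e: "e > 0" "ball p e \<subseteq> body" using mem_interior by blast
    \<comment> \<open>A step of length \<open>e / 2\<close> along the outward normal stays in the
      ball but leaves the half-space.\<close>
    define k where "k = e / (2 * norm (normal f))"
    have n: "normal f \<noteq> 0" by (cases f) (simp_all add: vec3_eq_iff)
    hence "k > 0" using e(1) by (simp add: k_def)
    have "p + k *\<^sub>R normal f \<in> ball p e" using n e(1) by (simp add: dist_norm k_def)
    hence "excess f (p + k *\<^sub>R normal f) \<le> 0" using e(2) by (auto simp: body_def)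
    moreover have "excess f (p + k *\<^sub>R normal f) = excess f p + k * (normal f \<bullet> normal f)"
      by (simp add: excess_eq inner_add_right)
    ultimately show False
      using half_faceD(2)[OF p] mult_pos_pos[OF \<open>k > 0\<close>, of "normal f \<bullet> normal f"] n by auto
  qed
  ultimately show "p \<in> frontier body"
    using closure_subset by (auto simp: frontier_def)
qed

lemma frontier_body: "frontier body = \<Union>pieces"
proof -
  have fr: "p \<in> frontier body \<longleftrightarrow> p \<in> body \<and> p \<notin> interior body" for p
    using polyhedron_imp_closed[OF polyhedron_body] by (simp add: frontier_def)
  hence refl: "reflect p \<in> frontier body \<longleftrightarrow> p \<in> frontier body" for p
    by (simp add: reflect_interior reflect_body)
  show ?thesis
  proof
    show "frontier body \<subseteq> \<Union>pieces"
    proof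
      fix p assume p: "p \<in> frontier body"
      have "\<exists>f. p \<in> half_face f \<or> reflect p \<in> half_face f"
        using half_face_if_nonneg[of p] half_face_if_nonneg[of "reflect p"] p refl[of p] fr
        by (cases "0 \<le> p $ 1") auto
      thus "p \<in> \<Union>pieces" by (auto simp: pieces_def mem_reflect_image)
    qed
    show "\<Union>pieces \<subseteq> frontier body"
      using half_face_subset_frontier refl by (auto simp: pieces_def)
  qed
qed

text \<open>The origin is absent: the path crosses the symmetry plane on the bottom without
  turning.\<close>

definition vertices :: "(real ^ 3) list" where
  "vertices = [point (-40016) (-8) 136, point (-40028) (-13) 136, point (-40040) (-16) 112,
    point (-40000) 0 0, point 40000 0 0, point 40040 (-16) 112, point 40028 (-13) 136,
    point 40016 (-8) 136]"

lemma path_image_vertices: "path_image (polygonal_path vertices) = route"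
proof -
  have refl: "reflect (point a b c) = point (- a) b c" "reflect 0 = 0" for a b c
    by (simp_all add: vec3_eq_iff)
  have half: "half_route = closed_segment 0 (point 40000 0 0)
      \<union> closed_segment (point 40000 0 0) (point 40040 (-16) 112)
      \<union> closed_segment (point 40040 (-16) 112) (point 40028 (-13) 136)
      \<union> closed_segment (point 40028 (-13) 136) (point 40016 (-8) 136)"
    by (auto simp: half_route_def UNIV_face)
  \<comment> \<open>The bottom leg and its mirror image meet at the origin and form one
    segment.\<close>
  have "0 \<in> closed_segment (point (-40000) 0 0) (point 40000 0 0)"
    unfolding in_segment by (rule exI[of _ "1/2"]) (simp add: vec3_eq_iff)
  from Un_closed_segment[OF this]
  have mid: "closed_segment (point (-40000) 0 0) (point 40000 0 0)
      = closed_segment 0 (point (-40000) 0 0) \<union> closed_segment 0 (point 40000 0 0)"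
    by (simp add: closed_segment_commute)
  show ?thesis
    unfolding route_def half image_Un reflect_closed_segment refl vertices_def path_image_polygonal_path
    unfolding polygonal_path.simps path_image_linepath mid
    by (auto simp: closed_segment_commute)
qed

lemma signed_height_ends:
  "signed_height (point 40016 (-8) 136) = 40160" "signed_height (point (-40016) (-8) 136) = - 40160"
proof -
  have p: "node_after Roof \<in> half_face Roof" using leg_subset_half_face by fastforce
  have h: "height Roof (node_after Roof) = 40160"
    using main_less_detour[of "node_after Roof" Roof] by (simp add: height_def main_simps)
  show "signed_height (point 40016 (-8) 136) = 40160"
    using signed_height_half_face[OF p] h by simp
  have "reflect (node_after Roof) = point (-40016) (-8) 136" by (simp add: vec3_eq_iff)
  thus "signed_height (point (-40016) (-8) 136) = - 40160"
    using signed_height_reflect[OF p] h by simp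
qed

lemma polygon_length_vertices: "polygon_length vertices = 80320"
  by (simp add: vertices_def dist_vec3)

lemma angle_vec3:
  assumes "dist a b = l" and "dist c b = m"
  shows "angle a b (c :: real ^ 3) = arccos (((a $ 1 - b $ 1) * (c $ 1 - b $ 1)
    + (a $ 2 - b $ 2) * (c $ 2 - b $ 2) + (a $ 3 - b $ 3) * (c $ 3 - b $ 3)) / (l * m))"
  using assms by (simp add: angle_def dist_norm inner_vec_def sum_3)

lemma total_curvature_vertices: "total_curvature vertices > 2 * pi"
proof -
  have "total_curvature vertices = 2 * (arccos (1/3) + arccos (2/3) + arccos (53/117))"
    unfolding vertices_def total_curvature_Cons
    \<comment> \<open>If consecutive directions have cosine \<open>u\<close>, the angle at the
      vertex is \<open>arccos (- u)\<close>, and \<open>arccos_minus\<close> turns \<open>pi\<close>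
      minus this angle into \<open>arccos u\<close>. Symmetry gives the factor 2.\<close>
    by (simp add: angle_vec3[OF dist_vec3 dist_vec3] arccos_minus)
  thus ?thesis using arccos_sum_gt_pi by simp
qed

text \<open>Uniqueness concerns path images, since monotone reparametrizations of a path have the
  same length.\<close>

theorem theorem2:
  shows "\<exists>(M :: (real ^ 3) set) x y.
    polyhedron M \<and> compact M \<and> interior M \<noteq> {} \<and> x \<in> frontier M \<and> y \<in> frontier M \<and>
    (\<exists>zs. zs \<noteq> [] \<and> distinct_adj zs \<and>
       shortest_boundary_path M x y (polygonal_path zs) \<and>
       (\<forall>g. shortest_boundary_path M x y g \<longrightarrow> path_image g = path_image (polygonal_path zs)) \<and>
       total_curvature zs > 2 * pi)"
proof -
  define x y :: "real ^ 3" where "x = point (-40016) (-8) 136" and "y = point 40016 (-8) 136"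
  define P where "P = polygonal_path vertices"
  have ends: "pathstart P = x" "pathfinish P = y"
    by (simp_all add: P_def vertices_def pathfinish_polygonal_path x_def y_def del: polygonal_path.simps)
  have img: "path_image P = route" unfolding P_def by (rule path_image_vertices)
  have route: "route \<subseteq> \<Union>pieces"
    using half_route_half_face by (auto simp: route_def pieces_def)
  have P: "boundary_path body x y P"
    unfolding boundary_path_def frontier_body using ends img route
    by (simp add: P_def path_polygonal_path)
  have height: "signed_height x = - 40160" "signed_height y = 40160"
    unfolding x_def y_def by (rule signed_height_ends)+
  have len: "path_length P \<le> ennreal 80320"
    unfolding P_def polygon_length_vertices[symmetric] by (rule path_length_polygonal_path)
  have lower: "ennreal 80320 \<le> path_length h" if "boundary_path body x y h" for h
    using surface.path_length_ge[of h] that height by (auto simp: boundary_path_def frontier_body)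
  have shortest: "shortest_boundary_path body x y P"
    using P len lower order_trans unfolding shortest_boundary_path_def by blast
  have "path_image g = path_image P" if "shortest_boundary_path body x y g" for g
  proof -
    have g: "path g" "pathstart g = x" "pathfinish g = y" "path_image g \<subseteq> \<Union>pieces"
      using that by (auto simp: shortest_boundary_path_def boundary_path_def frontier_body)
    have "path_length g \<le> path_length P"
      using that P unfolding shortest_boundary_path_def by blast
    hence tight: "path_length g \<le> ennreal (signed_height (pathfinish g) - signed_height (pathstart g))"
      using len g height by simp
    have "y \<in> route" using pathfinish_in_path_image[of P] ends img by simp
    have "path_image g \<subseteq> route"
    proof (rule surface.path_image_subset_if_tight[OF g(1,4) tight])
      fix p q
      assume "surface.linked p q" "q \<in> route" "dist p q = signed_height q - signed_height p"
        and "signed_height (pathstart g) \<le> signed_height p"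
      thus "p \<in> route" using tight_step g(2) height(1) by simp
    qed (simp_all add: g height \<open>y \<in> route\<close>)
    moreover have "signed_height ` route \<subseteq> {- 40160..40160}"
    proof -
      have "\<bar>signed_height p\<bar> \<le> 40160 \<and> \<bar>signed_height (reflect p)\<bar> \<le> 40160" if "p \<in> half_route" for p
        using signed_height_half_route[OF that] half_route_place[OF that] by simp
      thus ?thesis by (fastforce simp: route_def abs_le_iff)
    qed
    ultimately show ?thesis
      using surface.path_image_eq_if_inj[OF g(1) _ route inj_on_signed_height] g height img by simp
  qed
  moreover have "point 0 0 1 \<in> interior body"
    by (rule interior_body; case_tac f; simp)
  moreover have "x \<in> frontier body" "y \<in> frontier body"
    using P ends by (auto simp: boundary_path_def)
  moreover have "distinct_adj vertices" "vertices \<noteq> []"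
    by (simp_all add: vertices_def vec3_eq_iff)
  ultimately show ?thesis
    using polyhedron_body compact_body shortest total_curvature_vertices unfolding P_def by blast
qed

end
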